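(* Let $d=2$ and consider the evolution $$S_{t+1}(x)=S_t(x)+1_{\{S_t(x-1)-S_t(x)+S_t(x+1)-S_t(x)+\omega(x,S_t(x))>0\}} .$$ For integers $h,L\ge1$ let $H_L=L^3$ (that is, $a=2$ in $H_L=L^{a+1}$) and $C^{h,L}=([0,3hL)\times[0,H_L))\cap\mathbb{Z}^2$. Suppose that the variables $\omega(x,y)$, $(x,y)\in C^{h,L}$, are i.i.d. with a law not depending on $h,L$ and satisfying $$\exists\,\lambda_0>0:\qquad \mathbb{E}\big[\exp(-\lambda_0\,\omega(x,y))\big]<1-\exp(-\lambda_0),$$ and that $\omega=-\infty$ outside $C^{h,L}$. Then there exist $c_1,\kappa>0$ and an integer $h>1$ such that for every integer $L\ge c_1$, $$\mathbb{P}\big[\text{there exists a surface }S\text{ blocking }C^{h,L}\big]\le\exp(-\kappa\sqrt L).$$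
   Context: The variables $\omega(x,y)$ take values in $\mathbb{R}\cup\{-\infty\}$. A surface is any function $S:\mathbb{Z}\to\mathbb{Z}\cup\{-\infty\}$ (no Lipschitz condition). Conventions for the evolution: $-\infty+1=-\infty$, and the indicator (update) is $0$ if $S_t(x\pm1)-S_t(x)=-\infty$ for one of the signs or if $\omega(x,S_t(x))=-\infty$. $S$ is obstructed at $x$ if one step of the evolution started from $S$ does not change the value at $x$. Let $B^{h,L}=([hL,2hL)\times[0,L))\cap\mathbb{Z}^2$. A surface $S$ blocks $C^{h,L}$ if: (1) the graph of $S$ intersects $B^{h,L}$; (2) $S(x)\ge0$ for every $x\in[0,3hL)$; (3) for every $x\in[0,3hL)$ with $S(x)\le H_L$, $S$ is obstructed at $x$. *)

theory Defs
  imports "HOL-Probability.Probability" "HOL-Library.Extended"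
begin

no_notation Pinf (\<open>\<infinity>\<close>)
no_notation Minf (\<open>-\<infinity>\<close>)

text \<open>Heights live in the integers together with minus infinity; the extra element \<open>Pinf\<close> of the
  library type is excluded here.\<close>

definition surface :: "(int \<Rightarrow> int extended) \<Rightarrow> bool" where
  "surface S \<longleftrightarrow> (\<forall>x. S x \<noteq> Pinf)"

text \<open>The indicator in the evolution rule. It is 0 if a neighbouring height or \<open>\<omega> (x, S x)\<close> is minus
  infinity; the latter because a real number plus minus infinity is minus infinity in \<^typ>\<open>ereal\<close>.
  For \<open>S x = Minf\<close>, where \<open>\<omega> (x, S x)\<close> has no meaning, its value is immaterial, as
  \<open>Minf + 1 = Minf\<close>.\<close>

definition fires :: "(int \<times> int \<Rightarrow> ereal) \<Rightarrow> (int \<Rightarrow> int extended) \<Rightarrow> int \<Rightarrow> bool" where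
  "fires \<omega> S x \<longleftrightarrow>
     (\<exists>l y r. S (x - 1) = Fin l \<and> S x = Fin y \<and> S (x + 1) = Fin r \<and>
        ereal (real_of_int ((l - y) + (r - y))) + \<omega> (x, y) > 0)"

definition evolve :: "(int \<times> int \<Rightarrow> ereal) \<Rightarrow> (int \<Rightarrow> int extended) \<Rightarrow> int \<Rightarrow> int extended" where
  "evolve \<omega> S x = S x + (if fires \<omega> S x then 1 else 0)"

definition obstructed :: "(int \<times> int \<Rightarrow> ereal) \<Rightarrow> (int \<Rightarrow> int extended) \<Rightarrow> int \<Rightarrow> bool" where
  "obstructed \<omega> S x \<longleftrightarrow> evolve \<omega> S x = S x"

definition height_bound :: "int \<Rightarrow> int" where
  "height_bound L = L ^ 3"

definition box_C :: "int \<Rightarrow> int \<Rightarrow> (int \<times> int) set" where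
  "box_C h L = {0..<3 * h * L} \<times> {0..<height_bound L}"

definition box_B :: "int \<Rightarrow> int \<Rightarrow> (int \<times> int) set" where
  "box_B h L = {h * L..<2 * h * L} \<times> {0..<L}"

definition blocks :: "(int \<times> int \<Rightarrow> ereal) \<Rightarrow> int \<Rightarrow> int \<Rightarrow> (int \<Rightarrow> int extended) \<Rightarrow> bool" where
  "blocks \<omega> h L S \<longleftrightarrow>
     (\<exists>x y. S x = Fin y \<and> (x, y) \<in> box_B h L) \<and>
     (\<forall>x\<in>{0..<3 * h * L}. S x \<ge> 0) \<and>
     (\<forall>x\<in>{0..<3 * h * L}. S x \<le> Fin (height_bound L) \<longrightarrow> obstructed \<omega> S x)"

definition exp_ereal :: "ereal \<Rightarrow> ennreal" where
  "exp_ereal z = (case z of ereal r \<Rightarrow> ennreal (exp r) | PInfty \<Rightarrow> \<infinity> | MInfty \<Rightarrow> 0)"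

definition iid_environment ::
  "'a measure \<Rightarrow> ereal measure \<Rightarrow> int \<Rightarrow> int \<Rightarrow> (int \<times> int \<Rightarrow> 'a \<Rightarrow> ereal) \<Rightarrow> bool" where
  "iid_environment M \<mu> h L \<omega> \<longleftrightarrow>
     prob_space M \<and>
     (\<forall>p. \<forall>w\<in>space M. \<omega> p w \<noteq> \<infinity>) \<and>
     prob_space.indep_vars M (\<lambda>_. borel) \<omega> (box_C h L) \<and>
     (\<forall>p\<in>box_C h L. distr M borel (\<omega> p) = \<mu>) \<and>
     (\<forall>p. p \<notin> box_C h L \<longrightarrow> (\<forall>w\<in>space M. \<omega> p w = -\<infinity>))"

text \<open>The following facts show that the expectation and the probability in the statement are those
  of a measurable function and of an event.\<close>

lemma exp_ereal_measurable [measurable]: "exp_ereal \<in> borel_measurable borel"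
proof -
  have "exp_ereal = (\<lambda>z. if z = \<infinity> then \<infinity> else if z = -\<infinity> then 0 else ennreal (exp (real_of_ereal z)))"
    by (auto simp: exp_ereal_def fun_eq_iff split: ereal.splits)
  moreover have "\<dots> \<in> borel_measurable borel" by measurable
  ultimately show ?thesis by simp
qed

lemma environment_measurable:
  assumes "iid_environment M \<mu> h L \<omega>"
  shows "\<omega> p \<in> borel_measurable M"
proof (cases "p \<in> box_C h L")
  case True
  then show ?thesis
    using assms by (auto simp: iid_environment_def prob_space.indep_vars_def)
next
  case False
  then have "\<omega> p w = -\<infinity>" if "w \<in> space M" for w
    using assms that unfolding iid_environment_def by blast
  then show ?thesis
    by (subst measurable_cong[where g = "\<lambda>_. -\<infinity>"]) auto
qed

lemma blocks_cong:
  assumes "h \<ge> 1" "L \<ge> 1" "\<And>x. x \<in> {-1..3 * h * L} \<Longrightarrow> S x = T x"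
  shows "blocks \<omega> h L S \<longleftrightarrow> blocks \<omega> h L T"
proof -
  have pos: "h * L \<ge> 1"
    using assms(1,2) mult_mono[of 1 h 1 L] by simp
  have eq: "S x = T x" if "-1 \<le> x" "x \<le> 3 * (h * L)" for x
    using assms(3)[of x] that by (simp add: mult.assoc)
  have "S x = Fin y \<and> (x, y) \<in> box_B h L \<longleftrightarrow> T x = Fin y \<and> (x, y) \<in> box_B h L" for x y
    using eq[of x] pos by (auto simp: box_B_def mult.assoc)
  moreover have "S x = T x \<and> obstructed \<omega> S x = obstructed \<omega> T x" if "x \<in> {0..<3 * h * L}" for x
    using eq[of x] eq[of "x - 1"] eq[of "x + 1"] that
    by (simp add: obstructed_def evolve_def fires_def mult.assoc)
  ultimately show ?thesis
    unfolding blocks_def by metis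
qed

lemma blocking_event:
  assumes env: "iid_environment M \<mu> h L \<omega>" and "h \<ge> 1" "L \<ge> 1"
  shows "{w \<in> space M. \<exists>S. surface S \<and> blocks (\<lambda>p. \<omega> p w) h L S} \<in> sets M"
proof -
  define A where "A = {-1..3 * h * L}"
  define cut :: "(int \<Rightarrow> int extended) \<Rightarrow> int \<Rightarrow> int extended"
    where "cut S x = (if x \<in> A then S x else Minf)" for S x
  define K where "K = cut ` (A \<rightarrow>\<^sub>E UNIV)"
  have "(UNIV :: int extended set) = insert Pinf (insert Minf (range Fin))"
    by (auto intro: extended.exhaust)
  then have "countable (UNIV :: int extended set)"
    by (metis countable_insert countableI_type countable_image)
  then have K: "countable K"
    unfolding K_def by (intro countable_image countable_PiE) (auto simp: A_def)
  have cut: "cut S \<in> K" for S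
  proof -
    have "cut S = cut (restrict S A)" by (auto simp: cut_def fun_eq_iff)
    then show ?thesis unfolding K_def by auto
  qed
  have "(\<exists>S. surface S \<and> blocks e h L S) \<longleftrightarrow> (\<exists>S\<in>K. surface S \<and> blocks e h L S)" for e
  proof
    assume "\<exists>S. surface S \<and> blocks e h L S"
    then obtain S where "surface S" "blocks e h L S" by auto
    moreover have "blocks e h L S \<longleftrightarrow> blocks e h L (cut S)"
      by (rule blocks_cong) (use assms in \<open>auto simp: cut_def A_def\<close>)
    moreover have "surface S \<Longrightarrow> surface (cut S)" by (auto simp: surface_def cut_def)
    ultimately show "\<exists>S\<in>K. surface S \<and> blocks e h L S" using cut by blast
  qed auto
  then have *: "{w \<in> space M. \<exists>S. surface S \<and> blocks (\<lambda>p. \<omega> p w) h L S} =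
      {w \<in> space M. \<exists>S\<in>K. surface S \<and> blocks (\<lambda>p. \<omega> p w) h L S}" by simp
  note [measurable] = environment_measurable[OF env]
  have [measurable]: "Measurable.pred M (\<lambda>w. obstructed (\<lambda>p. \<omega> p w) S x)" for S x
  proof -
    have f: "Measurable.pred M (\<lambda>w. fires (\<lambda>p. \<omega> p w) S x)"
      unfolding fires_def
      by (cases "S (x - 1)"; cases "S x"; cases "S (x + 1)") simp_all
    have "obstructed e S x \<longleftrightarrow> fires e S x \<and> S x + 1 = S x \<or> \<not> fires e S x" for e
      by (simp add: obstructed_def evolve_def)
    then show ?thesis using f by simp
  qed
  show ?thesis
    unfolding * unfolding blocks_def using K by measurable
qed

end

theory Submission
  imports Defs "HOL-Real_Asymp.Real_Asymp"
begin

text \<open>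
  Read a blocking surface along the columns, away from a point of its graph in the box \<open>box_B\<close>.
  Where it is obstructed at height \<open>y\<close> in column \<open>x\<close>, its next slope \<open>g'\<close> and its previous slope
  \<open>g\<close> satisfy \<open>g' - g + \<omega> (x, y) \<le> 0\<close>. Weighting a possible continuation by \<open>exp (l * g')\<close>, the
  expected total weight after one column is at most \<open>exp (l * g)\<close> times
  \<^item> the geometric sum over all integer slopes \<open>g' \<le> g - \<omega> (x, y)\<close>, which contributes a factor
    \<open>1 / (1 - exp (- l))\<close>, and
  \<^item> the moment \<open>E[exp (- l * \<omega> (x, y))]\<close>.

  The hypothesis says exactly that the product of these two factors is less than some \<open>\<rho> < 1\<close>. Each
  column is visited once, so the steps are independent, and the probability that some continuation of
  \<open>n\<close> steps from a fixed site and initial slope 0 ends with slope at least \<open>G\<close> is at most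
  \<open>\<rho> ^ n * exp (- l * G)\<close> (\<open>prob_steep_path\<close>). Writing \<open>\<rho> = exp (- l * c)\<close> and taking
  \<open>G = sqrt L - c * n\<close>, this is \<open>exp (- l * sqrt L)\<close> for every \<open>n\<close>.

  On the other hand, starting at a site of the surface in \<open>box_B\<close> or at its left neighbour, one can
  walk to the right or to the left, arriving at the start with slope at most 0. If the slope after \<open>n\<close> steps were below \<open>sqrt L - c * n\<close> for every \<open>n\<close>,
  the height would stay below the parabola \<open>L + sqrt L * n - c / 2 * n\<^sup>2\<close>. The parabola has height of
  order \<open>L\<close>, hence below \<open>L ^ 3\<close>, so all columns on the way are obstructed; and it reaches 0 after
  \<open>n\<close> of order \<open>sqrt L\<close> steps, which fit into the strip of width \<open>6 * L\<close> obtained for \<open>h = 2\<close>. This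
  contradicts nonnegativity of the surface (\<open>blocks_imp_steep_path\<close>). A union bound over polynomially
  many starting sites and lengths \<open>n\<close> concludes.
\<close>

section \<open>Obstructed paths with a steep final slope\<close>

text \<open>The existence of an obstructed path of \<open>n\<close> steps in direction \<open>d\<close>, leaving only sites of \<open>C\<close>, that
  arrives at \<open>(x, y)\<close> with slope \<open>g\<close> and leaves its last column with slope at least \<open>G\<close>. Only the predicate, not
  the path, is kept: the recursion on the first step is what the independence of columns needs, and
  as a countable disjunction it is visibly an event.\<close>

primrec steep_path ::
  "(int \<times> int) set \<Rightarrow> int \<Rightarrow> (int \<times> int \<Rightarrow> ereal) \<Rightarrow> real \<Rightarrow> nat \<Rightarrow> int \<Rightarrow> int \<Rightarrow> int \<Rightarrow> bool" where
  "steep_path C d e G 0 x y g \<longleftrightarrow> G \<le> real_of_int g"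
| "steep_path C d e G (Suc n) x y g \<longleftrightarrow>
     (x, y) \<in> C \<and>
     (\<exists>g'. ereal (real_of_int (g' - g)) + e (x, y) \<le> 0 \<and> steep_path C d e G n (x + d) (y + g') g')"

text \<open>Because of this monotonicity, the union bound need not run over initial slopes: every path that
  starts with a nonpositive slope can be taken to start with slope 0.\<close>

lemma steep_path_mono_slope:
  assumes "steep_path C d e G n x y g" and "g \<le> f"
  shows "steep_path C d e G n x y f"
proof (cases n)
  case 0
  then show ?thesis using assms by auto
next
  case (Suc m)
  have "ereal (real_of_int (k - f)) + e (x, y) \<le> ereal (real_of_int (k - g)) + e (x, y)" for k
    using assms(2) by (intro add_right_mono) simp
  then show ?thesis
    using assms(1) unfolding Suc steep_path.simps by (meson order_trans)
qed

lemma ahead_step: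
  fixes d x :: int
  assumes "d \<noteq> 0" "{q\<in>C. d * x \<le> d * fst q} \<subseteq> B"
  shows "{q\<in>C. d * (x + d) \<le> d * fst q} \<subseteq> B"
proof -
  have "d * x \<le> d * (x + d)" by (simp add: algebra_simps)
  then show ?thesis using assms(2) by (auto intro: order_trans)
qed

text \<open>A path never looks behind its starting column; multiplying by \<open>d\<close> expresses ``ahead in
  direction \<open>d\<close>'' for both directions at once. This is the source of independence below.\<close>

lemma steep_path_restrict:
  assumes "d \<noteq> 0" "{q\<in>C. d * x \<le> d * fst q} \<subseteq> B"
  shows "steep_path C d (restrict e B) G n x y g \<longleftrightarrow> steep_path C d e G n x y g"
  using assms
proof (induction n arbitrary: x y g)
  case (Suc n)
  have "steep_path C d (restrict e B) G n (x + d) u k \<longleftrightarrow> steep_path C d e G n (x + d) u k" for u k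
    by (rule Suc.IH[OF Suc.prems(1) ahead_step[OF Suc.prems]])
  moreover have "(x, y) \<in> B" if "(x, y) \<in> C" using Suc.prems that by auto
  ultimately show ?case by (auto simp del: restrict_apply simp: restrict_apply')
qed simp

lemma steep_path_measurable:
  assumes "d \<noteq> 0" "{q\<in>C. d * x \<le> d * fst q} \<subseteq> B"
    and "\<And>p. p \<in> B \<Longrightarrow> (\<lambda>w. X w p) \<in> borel_measurable N"
  shows "Measurable.pred N (\<lambda>w. steep_path C d (X w) G n x y g)"
  using assms(2)
proof (induction n arbitrary: x y g)
  case (Suc n)
  show ?case
  proof (cases "(x, y) \<in> C")
    case True
    have [measurable]: "Measurable.pred N (\<lambda>w. steep_path C d (X w) G n (x + d) u k)" for u k
      by (rule Suc.IH[OF ahead_step[OF assms(1) Suc.prems]])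
    have [measurable]: "(\<lambda>w. X w (x, y)) \<in> borel_measurable N"
      by (rule assms(3)) (use Suc.prems True in auto)
    show ?thesis unfolding steep_path.simps by measurable
  qed simp
qed simp

section \<open>The probability of a steep path\<close>

text \<open>The first condition concerns the single site \<open>(x, y)\<close>, the second only sites of columns strictly
  ahead of \<open>x\<close>.\<close>

lemma prob_step_inter_steep_path:
  assumes "prob_space M" and ind: "prob_space.indep_vars M (\<lambda>_. borel) \<omega> C"
    and d: "d \<noteq> 0" and p: "(x, y) \<in> C"
  shows "emeasure M ({w\<in>space M. ereal a + \<omega> (x, y) w \<le> 0} \<inter>
        {w\<in>space M. steep_path C d (\<lambda>q. \<omega> q w) G n (x + d) u k})
    = emeasure M {w\<in>space M. ereal a + \<omega> (x, y) w \<le> 0} *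
      emeasure M {w\<in>space M. steep_path C d (\<lambda>q. \<omega> q w) G n (x + d) u k}"
proof -
  interpret prob_space M by fact
  define A where "A = {(x, y)}"
  define B where "B = {q\<in>C. d * (x + d) \<le> d * fst q}"
  have "d * x < d * (x + d)" using d by (simp add: distrib_left zero_less_mult_iff linorder_neq_iff disj_commute)
  then have AB: "A \<inter> B = {}" "A \<subseteq> C" "B \<subseteq> C" using p by (auto simp: A_def B_def)
  note iv = indep_var_restrict[OF ind AB]
  define EA where "EA = {f \<in> space (PiM A (\<lambda>_. borel)). ereal a + f (x, y) \<le> 0}"
  define EB where "EB = {f \<in> space (PiM B (\<lambda>_. borel)). steep_path C d f G n (x + d) u k}"
  have [measurable]: "(\<lambda>f. f (x, y)) \<in> borel_measurable (PiM A (\<lambda>_. borel))"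
    by (rule measurable_component_singleton) (simp add: A_def)
  have EA: "EA \<in> sets (PiM A (\<lambda>_. borel))" unfolding EA_def by measurable
  have [measurable]: "Measurable.pred (PiM B (\<lambda>_. borel)) (\<lambda>f. steep_path C d f G n (x + d) u k)"
    by (rule steep_path_measurable[where B = B]) (use d in \<open>auto simp: B_def\<close>)
  have EB: "EB \<in> sets (PiM B (\<lambda>_. borel))" unfolding EB_def by measurable
  have "steep_path C d (restrict e B) G n (x + d) u k \<longleftrightarrow> steep_path C d e G n (x + d) u k" for e
    by (rule steep_path_restrict) (use d in \<open>auto simp: B_def\<close>)
  then have vB: "(\<lambda>w. restrict (\<lambda>i. \<omega> i w) B) -` EB \<inter> space M =
      {w\<in>space M. steep_path C d (\<lambda>q. \<omega> q w) G n (x + d) u k}"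
    by (auto simp: EB_def space_PiM)
  have vA: "(\<lambda>w. restrict (\<lambda>i. \<omega> i w) A) -` EA \<inter> space M = {w\<in>space M. ereal a + \<omega> (x, y) w \<le> 0}"
    by (auto simp: EA_def space_PiM A_def)
  have "(\<lambda>w. (restrict (\<lambda>i. \<omega> i w) A, restrict (\<lambda>i. \<omega> i w) B)) -` (EA \<times> EB) \<inter> space M =
      ((\<lambda>w. restrict (\<lambda>i. \<omega> i w) A) -` EA \<inter> space M) \<inter> ((\<lambda>w. restrict (\<lambda>i. \<omega> i w) B) -` EB \<inter> space M)"
    by auto
  with indep_varD[OF iv EA EB] show ?thesis
    unfolding vA vB by (simp add: emeasure_eq_measure ennreal_mult)
qed

lemma sum_exp_int_atMost:
  fixes m :: int
  assumes "l > 0"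
  shows "(\<integral>\<^sup>+ k. ennreal (exp (l * real_of_int k)) \<partial>count_space {..m}) =
    ennreal (exp (l * real_of_int m) / (1 - exp (- l)))"
proof -
  have bij: "bij_betw (\<lambda>j. m - int j) UNIV {..m}"
    by (rule bij_betwI[where g = "\<lambda>k. nat (m - k)"]) auto
  have "(\<integral>\<^sup>+ k. ennreal (exp (l * real_of_int k)) \<partial>count_space {..m})
     = (\<integral>\<^sup>+ j. ennreal (exp (l * real_of_int (m - int j))) \<partial>count_space UNIV)"
    using nn_integral_bij_count_space[OF bij, of "\<lambda>k. ennreal (exp (l * real_of_int k))"] by simp
  also have "\<dots> = (\<Sum>j. ennreal (exp (l * real_of_int m) * exp (- l) ^ j))"
    unfolding nn_integral_count_space_nat
    by (simp add: exp_of_nat_mult[symmetric] exp_add[symmetric] algebra_simps)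
  also have "\<dots> = ennreal (exp (l * real_of_int m) * (1 / (1 - exp (- l))))"
    by (rule suminf_ennreal_eq, simp, rule sums_mult, rule geometric_sums) (use assms in simp)
  finally show ?thesis by simp
qed

text \<open>The exponential weight of all slopes that can follow \<open>g\<close> where the noise is \<open>z\<close>. They are the
  integers up to the floor of \<open>g - z\<close>, so the sum is geometric. For \<open>z = - \<infinity>\<close> every slope is allowed
  and both sides are infinite.\<close>

lemma sum_exp_slopes_le:
  fixes g :: int and z :: ereal
  assumes l: "l > 0"
  shows "(\<integral>\<^sup>+ k. indicator {k. ereal (real_of_int (k - g)) + z \<le> 0} k * ennreal (exp (l * real_of_int k))
      \<partial>count_space UNIV) \<le> ennreal (exp (l * real_of_int g) / (1 - exp (- l))) * exp_ereal (ereal (- l) * z)"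
proof -
  have pos: "0 < 1 - exp (- l)" using l by simp
  show ?thesis
  proof (cases z)
    case (real r)
    define m where "m = \<lfloor>real_of_int g - r\<rfloor>"
    have set: "{k. ereal (real_of_int (k - g)) + z \<le> 0} = {..m}"
      by (auto simp: real m_def le_floor_iff zero_ereal_def)
    have "(\<integral>\<^sup>+ k. indicator {..m} k * ennreal (exp (l * real_of_int k)) \<partial>count_space UNIV)
        = (\<integral>\<^sup>+ k. ennreal (exp (l * real_of_int k)) \<partial>count_space {..m})"
      by (simp add: nn_integral_count_space_indicator mult.commute)
    also have "\<dots> = ennreal (exp (l * real_of_int m) / (1 - exp (- l)))"
      by (rule sum_exp_int_atMost[OF l])
    also have "\<dots> \<le> ennreal (exp (l * (real_of_int g - r)) / (1 - exp (- l)))"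
      using l pos by (intro ennreal_leI divide_right_mono) (auto simp: m_def)
    also have "\<dots> = ennreal (exp (l * real_of_int g) / (1 - exp (- l))) * exp_ereal (ereal (- l) * z)"
      using pos by (simp add: real exp_ereal_def ennreal_mult[symmetric] exp_add[symmetric] algebra_simps)
    finally show ?thesis unfolding set .
  next
    case PInf
    then show ?thesis by simp
  next
    case MInf
    then have "exp_ereal (ereal (- l) * z) = top"
      using l by (simp add: exp_ereal_def infinity_ennreal_def)
    then show ?thesis using pos by (simp add: ennreal_mult_top)
  qed
qed

text \<open>Induction on the first step: sum over the next slope \<open>k\<close>, factorise by independence, use the
  induction hypothesis for the remaining path, and recombine. The weight \<open>exp (l * k)\<close> supplied by the
  induction hypothesis is summable against the step probabilities by \<open>sum_exp_slopes_le\<close>, and the moment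
  assumption makes the resulting factor \<open>\<rho>\<close>. The base case is the
  bound of the indicator of \<open>G \<le> g\<close> by \<open>exp (l * (g - G))\<close>.\<close>

lemma prob_steep_path:
  assumes M: "prob_space M" and ind: "prob_space.indep_vars M (\<lambda>_. borel) \<omega> C"
    and d: "d \<noteq> 0" and l: "l > 0" and \<rho>: "\<rho> \<ge> 0"
    and moment: "\<And>p. p \<in> C \<Longrightarrow> (\<integral>\<^sup>+ w. exp_ereal (ereal (- l) * \<omega> p w) \<partial>M) \<le> ennreal (\<rho> * (1 - exp (- l)))"
  shows "emeasure M {w\<in>space M. steep_path C d (\<lambda>q. \<omega> q w) G n x y g}
    \<le> ennreal (\<rho> ^ n * exp (l * (real_of_int g - G)))"
proof (induction n arbitrary: x y g)
  case 0
  interpret prob_space M by fact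
  show ?case
  proof (cases "G \<le> real_of_int g")
    case True
    then have "1 \<le> exp (l * (real_of_int g - G))" using l by simp
    then show ?thesis using True by (simp add: emeasure_space_1)
  qed simp
next
  case (Suc n)
  interpret prob_space M by fact
  have pos: "0 < 1 - exp (- l)" using l by simp
  have mC: "random_variable borel (\<omega> p)" if "p \<in> C" for p
    using ind that by (auto simp: indep_vars_def)
  show ?case
  proof (cases "(x, y) \<in> C")
    case True
    note [measurable] = mC[OF True]
    define X where "X k = {w\<in>space M. ereal (real_of_int (k - g)) + \<omega> (x, y) w \<le> 0}" for k
    define Y where "Y k = {w\<in>space M. steep_path C d (\<lambda>q. \<omega> q w) G n (x + d) (y + k) k}" for k
    define E where "E = {w\<in>space M. steep_path C d (\<lambda>q. \<omega> q w) G (Suc n) x y g}"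
    define K where "K = \<rho> ^ n * exp (- (l * G))"
    have K: "K \<ge> 0" using \<rho> by (simp add: K_def)
    have X[measurable]: "X k \<in> sets M" for k unfolding X_def by measurable
    have [measurable]: "Measurable.pred M (\<lambda>w. steep_path C d (\<lambda>q. \<omega> q w) G m u v k)" for m u v k
      by (rule steep_path_measurable[where B = C and X = "\<lambda>w q. \<omega> q w"]) (use d mC in auto)
    have Y[measurable]: "Y k \<in> sets M" for k unfolding Y_def by measurable
    have E[measurable]: "E \<in> sets M" unfolding E_def by measurable
    have "emeasure M E = (\<integral>\<^sup>+ w. indicator E w \<partial>M)" by simp
    also have "\<dots> \<le> (\<integral>\<^sup>+ w. (\<integral>\<^sup>+ k. indicator (X k \<inter> Y k) w \<partial>count_space UNIV) \<partial>M)"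
    proof (rule nn_integral_mono)
      fix w assume w: "w \<in> space M"
      show "(indicator E w :: ennreal) \<le> (\<integral>\<^sup>+ k. indicator (X k \<inter> Y k) w \<partial>count_space UNIV)"
      proof (cases "w \<in> E")
        case True
        then obtain k where "w \<in> X k \<inter> Y k" by (auto simp: E_def X_def Y_def)
        then have "(indicator E w :: ennreal) = indicator (X k \<inter> Y k) w" using True by simp
        also have "\<dots> \<le> (\<integral>\<^sup>+ k. indicator (X k \<inter> Y k) w \<partial>count_space UNIV)"
          by (rule nn_integral_ge_point) simp
        finally show ?thesis .
      qed simp
    qed
    also have "\<dots> = (\<integral>\<^sup>+ k. (\<integral>\<^sup>+ w. indicator (X k \<inter> Y k) w \<partial>M) \<partial>count_space UNIV)"
      by (rule nn_integral_count_space_nn_integral) auto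
    also have "\<dots> = (\<integral>\<^sup>+ k. emeasure M (X k) * emeasure M (Y k) \<partial>count_space UNIV)"
      unfolding X_def Y_def
      by (intro nn_integral_cong)
        (subst prob_step_inter_steep_path[OF M ind d True, symmetric],
         rule nn_integral_indicator, use X Y in \<open>auto simp: X_def Y_def\<close>)
    also have "\<dots> \<le> (\<integral>\<^sup>+ k. emeasure M (X k) * ennreal (K * exp (l * real_of_int k)) \<partial>count_space UNIV)"
    proof (intro nn_integral_mono mult_left_mono)
      fix k
      have "emeasure M (Y k) \<le> ennreal (\<rho> ^ n * exp (l * (real_of_int k - G)))"
        unfolding Y_def by (rule Suc.IH)
      then show "emeasure M (Y k) \<le> ennreal (K * exp (l * real_of_int k))"
        by (simp add: K_def exp_add[symmetric] algebra_simps)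
    qed simp
    \<comment> \<open>Writing the step probability as an integral and exchanging it with the sum turns the tail
      probabilities of \<open>\<omega> (x, y)\<close> into its exponential moment.\<close>
    also have "\<dots> = (\<integral>\<^sup>+ k. (\<integral>\<^sup>+ w. indicator (X k) w * ennreal (K * exp (l * real_of_int k)) \<partial>M) \<partial>count_space UNIV)"
      by (simp add: nn_integral_multc)
    also have "\<dots> = (\<integral>\<^sup>+ w. (\<integral>\<^sup>+ k. indicator (X k) w * ennreal (K * exp (l * real_of_int k)) \<partial>count_space UNIV) \<partial>M)"
      by (rule nn_integral_count_space_nn_integral[symmetric]) auto
    also have "\<dots> \<le> (\<integral>\<^sup>+ w. ennreal (K * exp (l * real_of_int g) / (1 - exp (- l))) *
         exp_ereal (ereal (- l) * \<omega> (x, y) w) \<partial>M)"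
    proof (rule nn_integral_mono)
      fix w assume w: "w \<in> space M"
      have "(\<integral>\<^sup>+ k. indicator (X k) w * ennreal (K * exp (l * real_of_int k)) \<partial>count_space UNIV)
         = (\<integral>\<^sup>+ k. ennreal K * (indicator {k. ereal (real_of_int (k - g)) + \<omega> (x, y) w \<le> 0} k *
              ennreal (exp (l * real_of_int k))) \<partial>count_space UNIV)"
        using w K by (intro nn_integral_cong) (simp add: X_def ennreal_mult indicator_def)
      also have "\<dots> = ennreal K * (\<integral>\<^sup>+ k. (indicator {k. ereal (real_of_int (k - g)) + \<omega> (x, y) w \<le> 0} k *
              ennreal (exp (l * real_of_int k))) \<partial>count_space UNIV)"
        by (rule nn_integral_cmult) simp
      also have "\<dots> \<le> ennreal K * (ennreal (exp (l * real_of_int g) / (1 - exp (- l))) *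
          exp_ereal (ereal (- l) * \<omega> (x, y) w))"
        by (intro mult_left_mono sum_exp_slopes_le l) simp
      also have "\<dots> = ennreal (K * exp (l * real_of_int g) / (1 - exp (- l))) *
         exp_ereal (ereal (- l) * \<omega> (x, y) w)"
        using K pos by (simp add: mult.assoc[symmetric] ennreal_mult[symmetric])
      finally show "(\<integral>\<^sup>+ k. indicator (X k) w * ennreal (K * exp (l * real_of_int k)) \<partial>count_space UNIV) \<le>
         ennreal (K * exp (l * real_of_int g) / (1 - exp (- l))) * exp_ereal (ereal (- l) * \<omega> (x, y) w)" .
    qed
    also have "\<dots> = ennreal (K * exp (l * real_of_int g) / (1 - exp (- l))) *
         (\<integral>\<^sup>+ w. exp_ereal (ereal (- l) * \<omega> (x, y) w) \<partial>M)"
      by (rule nn_integral_cmult) measurable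
    also have "\<dots> \<le> ennreal (K * exp (l * real_of_int g) / (1 - exp (- l))) * ennreal (\<rho> * (1 - exp (- l)))"
      by (intro mult_left_mono moment True) simp
    also have "\<dots> = ennreal (\<rho> ^ Suc n * exp (l * (real_of_int g - G)))"
    proof -
      have "exp (l * (real_of_int g - G)) = exp (- (l * G)) * exp (l * real_of_int g)"
        by (simp add: exp_add[symmetric] algebra_simps)
      then have "K * exp (l * real_of_int g) / (1 - exp (- l)) * (\<rho> * (1 - exp (- l))) =
          \<rho> ^ Suc n * exp (l * (real_of_int g - G))"
        using pos by (simp add: K_def)
      then show ?thesis
        using K \<rho> pos by (simp add: ennreal_mult[symmetric])
    qed
    finally show ?thesis unfolding E_def .
  qed simp
qed

section \<open>A blocking surface contains a steep path\<close>

lemma steep_path_of_profile: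
  fixes s v :: "nat \<Rightarrow> int"
  assumes "\<And>i. s (Suc i) = s i + v (Suc i)"
    and "\<And>i. i < n \<Longrightarrow> (x + d * int i, s i) \<in> C"
    and "\<And>i. i < n \<Longrightarrow> ereal (real_of_int (v (Suc i) - v i)) + e (x + d * int i, s i) \<le> 0"
    and "G \<le> real_of_int (v n)"
  shows "steep_path C d e G n x (s 0) (v 0)"
  using assms
proof (induction n arbitrary: x s v)
  case (Suc n)
  have "steep_path C d e G n (x + d) (s (Suc 0)) (v (Suc 0))"
  proof (rule Suc.IH)
    fix i assume "i < n"
    then show "(x + d + d * int i, s (Suc i)) \<in> C"
      and "ereal (real_of_int (v (Suc (Suc i)) - v (Suc i))) + e (x + d + d * int i, s (Suc i)) \<le> 0"
      using Suc.prems(2)[of "Suc i"] Suc.prems(3)[of "Suc i"] by (simp_all add: algebra_simps)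
  qed (use Suc.prems in auto)
  then show ?case
    using Suc.prems(1)[of 0] Suc.prems(2)[of 0] Suc.prems(3)[of 0] by auto
qed simp

text \<open>If no prefix of the profile were steep, its slope after \<open>n\<close> steps would be less than
  \<open>K - c * n\<close>, and summing the slopes would keep the height below a parabola that stays below \<open>H\<close>
  (\<open>peak\<close>) and reaches 0 by time \<open>N\<close> (\<open>hit\<close>). The two bounds have to be proved together: obstruction,
  and with it the slope bound, is known only while the height is below \<open>H\<close>.\<close>

lemma nonneg_profile_has_steep_path:
  fixes s v :: "nat \<Rightarrow> int" and c K :: real and H L N
  assumes s: "\<And>i. s (Suc i) = s i + v (Suc i)"
    and start: "s 0 < L" "v 0 \<le> 0"
    and nonneg: "\<And>i. i \<le> N \<Longrightarrow> 0 \<le> s i"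
    and C: "\<And>i. i < N \<Longrightarrow> 0 \<le> s i \<Longrightarrow> s i < H \<Longrightarrow> (x + d * int i, s i) \<in> C"
    and obstr: "\<And>i. i < N \<Longrightarrow> s i < H \<Longrightarrow>
      ereal (real_of_int (v (Suc i) - v i)) + e (x + d * int i, s i) \<le> 0"
    and c: "c > 0"
    and peak: "real_of_int L + K\<^sup>2 / (2 * c) \<le> real_of_int H"
    and hit: "real_of_int L + K * real N - c / 2 * (real N)\<^sup>2 \<le> 0"
  shows "\<exists>n\<in>{1..N}. steep_path C d e (K - c * real n) n x (s 0) 0"
proof (rule ccontr)
  assume no: "\<not> ?thesis"
  define b where "b i = real_of_int L + K * real i - c / 2 * (real i)\<^sup>2" for i :: nat
  have b: "b i \<le> real_of_int H" for i
  proof -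
    have "0 \<le> (K - c * real i)\<^sup>2 / (2 * c)" using c by simp
    also have "\<dots> = K\<^sup>2 / (2 * c) - K * real i + c / 2 * (real i)\<^sup>2"
      using c by (simp add: power2_eq_square field_simps)
    finally show ?thesis using peak by (simp add: b_def)
  qed
  have "real_of_int (s n) < b n" if "n \<le> N" for n
    using that
  proof (induction n rule: less_induct)
    case (less n)
    show ?case
    proof (cases n)
      case 0
      then show ?thesis using start by (simp add: b_def)
    next
      case (Suc m)
      have below: "s i < H" if "i < n" for i
        using less.IH[OF that] b[of i] less.prems that by simp
      have "real_of_int (v n) < K - c * real n"
      proof (rule ccontr)
        assume "\<not> ?thesis"
        then have "steep_path C d e (K - c * real n) n x (s 0) (v 0)"
          by (intro steep_path_of_profile) (use s below C obstr nonneg less.prems in auto)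
        then have "steep_path C d e (K - c * real n) n x (s 0) 0"
          using start(2) by (rule steep_path_mono_slope)
        moreover have "n \<in> {1..N}" using less.prems Suc by simp
        ultimately show False using no by blast
      qed
      moreover have "real_of_int (s m) < b m"
        using less.IH[of m] less.prems Suc by simp
      ultimately have "real_of_int (s n) < b m + (K - c * real n)"
        using s[of m] by (simp add: Suc)
      \<comment> \<open>\<open>b n - b m = K - c * n + c / 2\<close>, as \<open>n = m + 1\<close>.\<close>
      also have "\<dots> \<le> b n"
        using c by (simp add: b_def Suc power2_eq_square field_simps)
      finally show ?thesis .
    qed
  qed
  from this[of N] nonneg[of N] hit show False by (simp add: b_def)
qed

text \<open>The direction of the walk is chosen by comparing a site of the surface in \<open>box_B\<close> with its left
  neighbour: if the surface does not rise into the site from the left, walk right from it; otherwise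
  the left neighbour is lower, and walking left from there starts with a negative slope. The second
  case is why the starting columns begin at \<open>2 * L - 1\<close>. All columns used and their neighbours lie in
  the strip, where the surface is finite, so being obstructed there is an inequality between slopes.\<close>

lemma blocks_imp_steep_path:
  fixes c K :: real
  assumes S: "surface S" and blocks: "blocks e 2 L S"
    and N: "1 \<le> N" "int N \<le> L" and c: "c > 0"
    and peak: "real_of_int L + K\<^sup>2 / (2 * c) \<le> real_of_int (height_bound L)"
    and hit: "real_of_int L + K * real N - c / 2 * (real N)\<^sup>2 \<le> 0"
  shows "\<exists>d\<in>{1, -1}. \<exists>x\<in>{2 * L - 1..<4 * L}. \<exists>y\<in>{0..<L}. \<exists>n\<in>{1..N}.
    steep_path (box_C 2 L) d e (K - c * real n) n x y 0"
proof -
  have L: "L \<ge> 1" using N by simp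
  define T where "T u = (case S u of Fin y \<Rightarrow> y | _ \<Rightarrow> 0)" for u
  from blocks have nonneg: "S u \<ge> 0" if "0 \<le> u" "u < 6 * L" for u
    using that by (auto simp: blocks_def)
  have T: "S u = Fin (T u)" "T u \<ge> 0" if "0 \<le> u" "u < 6 * L" for u
    using nonneg[OF that] S
    by (cases "S u"; auto simp: T_def surface_def zero_extended_def)+
  have obstr: "ereal (real_of_int ((T (u - 1) - T u) + (T (u + 1) - T u))) + e (u, T u) \<le> 0"
    if "1 \<le> u" "u \<le> 6 * L - 2" "T u < height_bound L" for u
  proof (rule ccontr)
    assume "\<not> ?thesis"
    then have "fires e S u" using T[of u] T[of "u - 1"] T[of "u + 1"] that by (auto simp: fires_def)
    moreover have "obstructed e S u" using blocks T[of u] that by (auto simp: blocks_def)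
    ultimately show False using T[of u] that by (simp add: obstructed_def evolve_def one_extended_def)
  qed
  have descend: "\<exists>n\<in>{1..N}. steep_path (box_C 2 L) d e (K - c * real n) n x (T x) 0"
    if d: "d = 1 \<or> d = -1" and x: "2 * L - 1 \<le> x" "x < 4 * L" and "T x < L" "T x \<le> T (x - d)" for d x
  proof -
    define s where "s i = T (x + d * int i)" for i
    define v where "v i = s i - T (x + d * int i - d)" for i
    have "\<exists>n\<in>{1..N}. steep_path (box_C 2 L) d e (K - c * real n) n x (s 0) 0"
    proof (rule nonneg_profile_has_steep_path[where v = v])
      show "s (Suc i) = s i + v (Suc i)" for i
        by (simp add: v_def s_def algebra_simps)
      show "s 0 < L" "v 0 \<le> 0" using that by (auto simp: s_def v_def)
      show "0 \<le> s i" if "i \<le> N" for i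
        unfolding s_def by (rule T) (use that d x N L in auto)
      show "(x + d * int i, s i) \<in> box_C 2 L" if "i < N" "0 \<le> s i" "s i < height_bound L" for i
        using that d x N L by (auto simp: box_C_def)
      show "ereal (real_of_int (v (Suc i) - v i)) + e (x + d * int i, s i) \<le> 0"
        if "i < N" "s i < height_bound L" for i
      proof -
        have "v (Suc i) - v i = (T (x + d * int i - 1) - s i) + (T (x + d * int i + 1) - s i)"
          using d by (auto simp: v_def s_def algebra_simps)
        then show ?thesis
          using obstr[of "x + d * int i"] that d x N L by (auto simp: s_def)
      qed
    qed (fact c peak hit)+
    then show ?thesis by (simp add: s_def)
  qed
  obtain x y where "S x = Fin y" "(x, y) \<in> box_B 2 L" using blocks by (auto simp: blocks_def)
  then have x: "2 * L \<le> x" "x < 4 * L" and Tx: "0 \<le> T x" "T x < L"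
    by (auto simp: box_B_def T_def)
  show ?thesis
  proof (cases "T x \<le> T (x - 1)")
    case True
    with descend[of 1 x] x Tx show ?thesis by fastforce
  next
    case False
    with descend[of "-1" "x - 1"] x Tx T[of "x - 1"] L show ?thesis by fastforce
  qed
qed

theorem lemma4p5:
  fixes \<mu> :: "ereal measure"
  assumes "prob_space \<mu>"
    and "sets \<mu> = sets borel"
    and "AE z in \<mu>. z \<noteq> \<infinity>"
    and "\<exists>l\<^sub>0>0. (\<integral>\<^sup>+ z. exp_ereal (ereal (- l\<^sub>0) * z) \<partial>\<mu>) < ennreal (1 - exp (- l\<^sub>0))"
  shows "\<exists>c\<^sub>1::real. \<exists>\<kappa>::real. \<exists>h::int. c\<^sub>1 > 0 \<and> \<kappa> > 0 \<and> h > 1 \<and>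
    (\<forall>L::int. real_of_int L \<ge> c\<^sub>1 \<longrightarrow>
      (\<forall>(M :: 'a measure) \<omega>. iid_environment M \<mu> h L \<omega> \<longrightarrow>
        measure M {w \<in> space M. \<exists>S. surface S \<and> blocks (\<lambda>p. \<omega> p w) h L S}
          \<le> exp (- \<kappa> * sqrt (real_of_int L))))"
proof -
  obtain l where l: "l > 0"
    and small: "(\<integral>\<^sup>+ z. exp_ereal (ereal (- l) * z) \<partial>\<mu>) < ennreal (1 - exp (- l))"
    using assms(4) by auto
  have pos: "0 < 1 - exp (- l)" using l by simp
  obtain a where a: "0 \<le> a" "(\<integral>\<^sup>+ z. exp_ereal (ereal (- l) * z) \<partial>\<mu>) = ennreal a"
    using small by (cases "\<integral>\<^sup>+ z. exp_ereal (ereal (- l) * z) \<partial>\<mu>") auto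
  have "a < 1 - exp (- l)" using small a by (simp add: ennreal_less_iff)
  have "a / (1 - exp (- l)) < 1" using \<open>a < 1 - exp (- l)\<close> pos by simp
  then obtain \<rho> where "a / (1 - exp (- l)) < \<rho>" "\<rho> < 1" using dense by blast
  moreover have "0 \<le> a / (1 - exp (- l))" using a pos by simp
  ultimately have \<rho>: "0 < \<rho>" "\<rho> < 1" "a / (1 - exp (- l)) \<le> \<rho>" by linarith+
  then have moment: "(\<integral>\<^sup>+ z. exp_ereal (ereal (- l) * z) \<partial>\<mu>) \<le> ennreal (\<rho> * (1 - exp (- l)))"
    unfolding a(2) using pos by (intro ennreal_leI) (simp add: field_simps)
  \<comment> \<open>The linear rate at which slopes fall: \<open>\<rho> = exp (- l * c)\<close>.\<close>
  define c where "c = - ln \<rho> / l"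
  have c: "c > 0" using \<rho> l by (simp add: c_def divide_neg_pos)
  have \<rho>_pow: "\<rho> ^ n = exp (- l * c * real n)" for n
    using \<rho> l by (simp add: c_def exp_of_nat_mult[symmetric] mult.commute[of _ "real n"] exp_of_nat_mult)
  \<comment> \<open>\<open>B * sqrt L\<close> steps suffice for the parabola to reach 0, since \<open>1 + B \<le> c / 2 * B\<^sup>2\<close>.\<close>
  define B where "B = 2 / c + 1"
  have B: "B > 0" using c by (simp add: B_def add_pos_pos)
  have "eventually (\<lambda>z::real. B * sqrt z + 1 \<le> z) at_top"
    using B by real_asymp
  moreover have "eventually (\<lambda>z::real. z + z / (2 * c) \<le> z ^ 3) at_top"
    using c by real_asymp
  moreover have "eventually (\<lambda>z::real. 2 * ((2 * z + 1) * (z * z)) * exp (- l * sqrt z) \<le> exp (- (l / 2) * sqrt z)) at_top"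
    using l by real_asymp
  ultimately have "eventually (\<lambda>z::real. B * sqrt z + 1 \<le> z \<and> z + z / (2 * c) \<le> z ^ 3 \<and>
      2 * ((2 * z + 1) * (z * z)) * exp (- l * sqrt z) \<le> exp (- (l / 2) * sqrt z)) at_top"
    by eventually_elim simp
  then obtain z\<^sub>0 where z\<^sub>0: "\<And>z. z \<ge> z\<^sub>0 \<Longrightarrow> B * sqrt z + 1 \<le> z \<and> z + z / (2 * c) \<le> z ^ 3 \<and>
      2 * ((2 * z + 1) * (z * z)) * exp (- l * sqrt z) \<le> exp (- (l / 2) * sqrt z)"
    unfolding eventually_at_top_linorder by blast
  have "measure M {w \<in> space M. \<exists>S. surface S \<and> blocks (\<lambda>p. \<omega> p w) 2 L S}
      \<le> exp (- (l / 2) * sqrt (real_of_int L))"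
    if L: "real_of_int L \<ge> max 1 z\<^sub>0" and env: "iid_environment M \<mu> 2 L \<omega>"
    for L and M :: "'a measure" and \<omega>
  proof -
    interpret prob_space M using env by (simp add: iid_environment_def)
    have ind: "indep_vars (\<lambda>_. borel) \<omega> (box_C 2 L)" using env by (simp add: iid_environment_def)
    have L1: "L \<ge> 1" and asym: "B * sqrt (real_of_int L) + 1 \<le> real_of_int L"
      "real_of_int L + real_of_int L / (2 * c) \<le> real_of_int L ^ 3"
      "2 * ((2 * real_of_int L + 1) * (real_of_int L * real_of_int L)) * exp (- l * sqrt (real_of_int L))
        \<le> exp (- (l / 2) * sqrt (real_of_int L))"
      using L z\<^sub>0[of "real_of_int L"] by auto
    define K where "K = sqrt (real_of_int L)"
    have K: "K > 0" "K\<^sup>2 = real_of_int L" using L1 by (auto simp: K_def)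
    define N where "N = nat \<lceil>B * K\<rceil>"
    have N_lower: "B * K \<le> real N" unfolding N_def by linarith
    have "0 < B * K" using B K by simp
    then have N_pos: "1 \<le> N" using N_lower by linarith
    have "real N \<le> B * K + 1" unfolding N_def using B K by simp
    then have NL: "int N \<le> L" using asym(1) unfolding K_def by linarith
    have hit: "real_of_int L + K * real N - c / 2 * (real N)\<^sup>2 \<le> 0"
    proof -
      have "c * B = 2 + c" using c by (simp add: B_def field_simps)
      then have "c / 2 * B = 1 + c / 2" by simp
      then have "c / 2 * (B * K) = (1 + c / 2) * K" by (simp only: mult.assoc[symmetric])
      moreover have "c / 2 * (B * K) \<le> c / 2 * real N"
        using N_lower c by (intro mult_left_mono) auto
      ultimately have slope: "(1 + c / 2) * K \<le> c / 2 * real N" by linarith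
      have "K * K \<le> (1 + c / 2) * K * K" using c K by (simp add: algebra_simps)
      also have "\<dots> \<le> c / 2 * real N * K" using slope K by (intro mult_right_mono) auto
      finally have "K * K + K * real N \<le> (1 + c / 2) * K * real N" by (simp add: algebra_simps)
      also have "\<dots> \<le> c / 2 * real N * real N" using slope by (intro mult_right_mono) auto
      finally show ?thesis using K(2) by (simp add: power2_eq_square algebra_simps)
    qed
    define bad where "bad = (\<lambda>(d, x, y, n).
      {w\<in>space M. steep_path (box_C 2 L) d (\<lambda>q. \<omega> q w) (K - c * real n) n x y 0})"
    define I :: "(int \<times> int \<times> int \<times> nat) set"
      where "I = {1, -1} \<times> {2 * L - 1..<4 * L} \<times> {0..<L} \<times> {1..nat L}"
    have [measurable]: "random_variable borel (\<omega> p)" for p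
      by (rule environment_measurable[OF env])
    have meas: "bad i \<in> events" if "i \<in> I" for i
    proof -
      obtain d x y n where i: "i = (d, x, y, n)" by (cases i)
      have "d \<noteq> 0" using that by (auto simp: I_def i)
      then have [measurable]: "Measurable.pred M
          (\<lambda>w. steep_path (box_C 2 L) d (\<lambda>q. \<omega> q w) (K - c * real n) n x y 0)"
        by (rule steep_path_measurable[where B = UNIV]) auto
      show ?thesis unfolding i bad_def by simp
    qed
    have each: "prob (bad i) \<le> exp (- l * K)" if "i \<in> I" for i
    proof -
      obtain d x y n where i: "i = (d, x, y, n)" by (cases i)
      have d: "d \<noteq> 0" using that by (auto simp: I_def i)
      have "(\<integral>\<^sup>+ w. exp_ereal (ereal (- l) * \<omega> p w) \<partial>M) \<le> ennreal (\<rho> * (1 - exp (- l)))"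
        if "p \<in> box_C 2 L" for p
      proof -
        have "distr M borel (\<omega> p) = \<mu>" using env that by (simp add: iid_environment_def)
        moreover have "(\<integral>\<^sup>+ z. exp_ereal (ereal (- l) * z) \<partial>distr M borel (\<omega> p)) =
            (\<integral>\<^sup>+ w. exp_ereal (ereal (- l) * \<omega> p w) \<partial>M)"
          by (rule nn_integral_distr) measurable
        ultimately show ?thesis using moment by simp
      qed
      then have "emeasure M (bad i) \<le> ennreal (\<rho> ^ n * exp (l * (real_of_int 0 - (K - c * real n))))"
        unfolding bad_def i prod.case
        by (rule prob_steep_path[OF prob_space_axioms ind d l less_imp_le[OF \<rho>(1)]])
      also have "\<rho> ^ n * exp (l * (real_of_int 0 - (K - c * real n))) = exp (- l * K)"
        unfolding \<rho>_pow by (simp add: exp_add[symmetric] algebra_simps)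
      finally show ?thesis by (simp add: emeasure_eq_measure)
    qed
    have cover: "{w \<in> space M. \<exists>S. surface S \<and> blocks (\<lambda>p. \<omega> p w) 2 L S} \<subseteq> (\<Union>i\<in>I. bad i)"
    proof
      fix w assume "w \<in> {w \<in> space M. \<exists>S. surface S \<and> blocks (\<lambda>p. \<omega> p w) 2 L S}"
      then obtain S where w: "w \<in> space M" and S: "surface S" "blocks (\<lambda>p. \<omega> p w) 2 L S" by blast
      have "real_of_int L + K\<^sup>2 / (2 * c) \<le> real_of_int (height_bound L)"
        using asym(2) by (simp add: K(2) height_bound_def)
      from blocks_imp_steep_path[OF S N_pos NL c this hit] obtain d x y n
        where path: "d \<in> {1, -1}" "x \<in> {2 * L - 1..<4 * L}" "y \<in> {0..<L}" "n \<in> {1..N}"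
          "steep_path (box_C 2 L) d (\<lambda>p. \<omega> p w) (K - c * real n) n x y 0"
        by blast
      have "n \<in> {1..nat L}" using path(4) NL by auto
      with path have "(d, x, y, n) \<in> I" unfolding I_def by blast
      moreover have "w \<in> bad (d, x, y, n)" using path(5) w by (simp add: bad_def)
      ultimately show "w \<in> (\<Union>i\<in>I. bad i)" by blast
    qed
    have fin: "finite I" by (simp add: I_def)
    have "card I = 2 * (nat (2 * L + 1) * (nat L * nat L))"
      by (simp add: I_def card_cartesian_product)
    then have card: "real (card I) = 2 * ((2 * real_of_int L + 1) * (real_of_int L * real_of_int L))"
      using L1 by simp
    have "prob {w \<in> space M. \<exists>S. surface S \<and> blocks (\<lambda>p. \<omega> p w) 2 L S} \<le> prob (\<Union>i\<in>I. bad i)"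
      using cover meas fin by (intro finite_measure_mono) auto
    also have "\<dots> \<le> (\<Sum>i\<in>I. prob (bad i))"
      using meas fin by (intro finite_measure_subadditive_finite) auto
    also have "\<dots> \<le> real (card I) * exp (- l * K)"
      using sum_bounded_above[of I "\<lambda>i. prob (bad i)"] each by simp
    also have "\<dots> \<le> exp (- (l / 2) * sqrt (real_of_int L))"
      unfolding card K_def by (rule asym(3))
    finally show ?thesis .
  qed
  then show ?thesis
    using l by (intro exI[of _ "max 1 z\<^sub>0"] exI[of _ "l / 2"] exI[of _ "2::int"]) auto
qed

end
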